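(* Assume each $f_i:\mathbb R^d\to\mathbb R$ ($i=1,\dots,m$) is $\mu_i$-strongly convex with $\mu_i>0$ and twice differentiable, with $L_{1,i}$-Lipschitz gradient and $L_{2,i}$-Lipschitz Hessian (operator norm); put $\bar\mu=\frac1m\sum_i\mu_i$. Let $\varepsilon>0$ be the desired accuracy, $D=\max\{\|x-x^*\|: f(x)\le f(\bar x^0)+\varepsilon\}$, $\gamma=1/D$ and $$\alpha=\min\Big\{\tfrac12,\sqrt{\tfrac{3\bar\mu}{16(L+\bar L_2)D}}\Big\}.$$ Let the inexactness levels of the Decentralized Cubic Newton algorithm (see context) be chosen, for every $k=0,\dots,N$, as $$\hat\Delta_{\hat x,k}=\hat\Delta_{\hat x}\le\min\Big\{\tfrac{\alpha\varepsilon}{24\bar L_1D},\ \sqrt[3]{\tfrac{\alpha\varepsilon}{4(L+\bar L_2)}},\ 2D\sqrt{\tfrac{\alpha\varepsilon\bar L_1}{3\bar\mu D^2\bar L_1+4\alpha\varepsilon(2\bar L_1+D\bar L_2)}},\ \tfrac{\bar\mu}{64(\bar L_1/D+\bar L_2)}\Big\},$$ $$\hat\Delta_{g|\hat x,k}=\hat\Delta_{g|\hat x}\le\min\Big\{\tfrac{\alpha\varepsilon}{12D},\tfrac{\bar\mu D}{32}\Big\},\qquad \hat\Delta_{H|\hat x,k}=\hat\Delta_{H|\hat x}\le\tfrac{\bar\mu}{16}.$$ Assume that the parameters of the algorithm satisfy $\delta_{1,k}=\delta_1\ge\hat\Delta_{g|\hat x}+2\bar L_1\hat\Delta_{\hat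 x}$, $\delta_{2,k}=\delta_2\ge\hat\Delta_{H|\hat x}+2\bar L_2\hat\Delta_{\hat x}$, and $L\ge\bar L_2$. Then after $N+1$ iterations with $$N=\Big\lceil\tfrac1\alpha\log\Big(\tfrac{2(f(\bar x^0)-f(x^* ))}{\varepsilon}\Big)\Big\rceil-1$$ the method outputs an $\varepsilon$-solution, i.e. $f(\bar x^{N+1})-f(x^* )\le\varepsilon$.
   Context: Setting: $m$ nodes, $f=\frac1m\sum_{i=1}^m f_i$ on $\mathbb R^d$, $x^*$ the minimizer of $f$. $\bar L_p=\frac1m\sum_{i=1}^m L_{p,i}$, $p=1,2$. $\|\cdot\|$ is the Euclidean norm, $\|\cdot\|_{\rm op}$ the operator norm. Consensus: there is a sequence of mixing matrices $W^k\in\mathbb R^{m\times m}$ with nonnegative entries, $W^k\mathbf 1=\mathbf 1$, $\mathbf 1^\top W^k=\mathbf 1^\top$. $\mathrm{Consensus}(\{u_j\}_{j=1}^m,T)$ stacks the $u_j^\top$ as rows of a matrix $U$ and multiplies it by a product of $T$ consecutive mixing matrices; node $i$ receives the $i$-th row. Hessians are flattened into vectors of $\mathbb R^{d^2}$. Decentralized Cubic Newton: given initial points $x_1^0,\dots,x_m^0$, a number $N$, $L>0$, $\gamma>0$, $\delta_{1,k},\delta_{2,k}\ge0$, and numbers of consensus rounds, for $k=0,\dots,N$ each node $i$: 1. obtains $\hat x_i^k$ as its output of Consensus applied to $\{x_j^k\}_j$; 2. obtains $\hat g_i(\hat x_i^k)$ and $\hat H_i(\hat x_i^k)$ as its outputs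 of Consensus applied to $\{\nabla f_j(\hat x_j^k)\}_j$ and $\{\nabla^2f_j(\hat x_j^k)\}_j$; 3. sets $x_i^{k+1}=\arg\min_{x}\hat\omega_i^k(x;\hat x_i^k)$, where $$\hat\omega_i^k(x;\hat x_i^k)=\langle\hat g_i(\hat x_i^k),x-\hat x_i^k\rangle+\tfrac12\langle\hat H_i(\hat x_i^k)(x-\hat x_i^k),x-\hat x_i^k\rangle+\tfrac{\delta_{1,k}}{2\gamma}+\tfrac{\gamma\delta_{1,k}+\delta_{2,k}}2\|x-\hat x_i^k\|^2+\tfrac L6\|x-\hat x_i^k\|^3.$$ $\bar x^k=\frac1m\sum_i x_i^k$. The inexactness (consensus error) levels are numbers such that $\max_i\|\hat x_i^k-\bar x^k\|\le\hat\Delta_{\hat x,k}$, $\max_i\|\hat g_i(\hat x_i^k)-\frac1m\sum_j\nabla f_j(\hat x_j^k)\|\le\hat\Delta_{g|\hat x,k}$, $\max_i\|\hat H_i(\hat x_i^k)-\frac1m\sum_j\nabla^2f_j(\hat x_j^k)\|_{\rm op}\le\hat\Delta_{H|\hat x,k}$.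
   Formalization: Upper bounds are added: δ₁ and δ₂ are at most the values of their stated lower bounds with each inexactness level replaced by its largest admissible value; without them the claim fails (f=x²/2, x⁰=1, ε=L=0.01, zero errors, δ₂=0, δ₁=1000). *)

theory Defs
  imports "HOL-Analysis.Analysis"
begin

definition mean :: "('m::finite \<Rightarrow> 'a::real_vector) \<Rightarrow> 'a" where
  "mean u = (1 / real CARD('m)) *\<^sub>R (\<Sum>i\<in>UNIV. u i)"

definition strongly_convex :: "real \<Rightarrow> ('a::real_normed_vector \<Rightarrow> real) \<Rightarrow> bool" where
  "strongly_convex \<mu> f \<longleftrightarrow> (\<forall>x y. \<forall>t\<in>{0..1}.
     f ((1 - t) *\<^sub>R x + t *\<^sub>R y)
       \<le> (1 - t) * f x + t * f y - \<mu> / 2 * (t * (1 - t)) * (norm (x - y))\<^sup>2)"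

definition mixing_matrix :: "real^'m^'m \<Rightarrow> bool" where
  "mixing_matrix A \<longleftrightarrow> (\<forall>i j. 0 \<le> A $ i $ j) \<and> A *v vec 1 = vec 1 \<and> vec 1 v* A = vec 1"

(* W (s + T - 1) ** ... ** W (s + 1) ** W s *)
primrec mixing_product :: "(nat \<Rightarrow> real^'m^'m) \<Rightarrow> nat \<Rightarrow> nat \<Rightarrow> real^'m^'m" where
  "mixing_product W s 0 = mat 1"
| "mixing_product W s (Suc T) = W (s + T) ** mixing_product W s T"

(* The rows of the stacked matrix are the vectors held by the nodes. The argument s is the
   position in the sequence W at which this communication phase starts. *)
definition consensus ::
    "(nat \<Rightarrow> real^'m^'m) \<Rightarrow> nat \<Rightarrow> nat \<Rightarrow> ('m \<Rightarrow> real^'p) \<Rightarrow> 'm \<Rightarrow> real^'p" where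
  "consensus W s T u i = (mixing_product W s T ** (\<chi> j. u j)) $ i"

definition flatten :: "real^'d^'d \<Rightarrow> real^('d \<times> 'd)" where
  "flatten A = (\<chi> p. A $ fst p $ snd p)"

definition unflatten :: "real^('d \<times> 'd) \<Rightarrow> real^'d^'d" where
  "unflatten v = (\<chi> a b. v $ (a, b))"

(* Operator norm for the Euclidean norm; the norm of the type real^'d^'d itself is the
   Frobenius norm. *)
abbreviation opnorm :: "real^'d^'d \<Rightarrow> real" where
  "opnorm A \<equiv> onorm (\<lambda>v. A *v v)"

definition cubic_model ::
    "real \<Rightarrow> real \<Rightarrow> real \<Rightarrow> real \<Rightarrow> real^'d \<Rightarrow> real^'d^'d \<Rightarrow> real^'d \<Rightarrow> real^'d \<Rightarrow> real" where
  "cubic_model L \<gamma> \<delta>1 \<delta>2 g H z x =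
     g \<bullet> (x - z) + 1 / 2 * ((H *v (x - z)) \<bullet> (x - z)) + \<delta>1 / (2 * \<gamma>)
     + (\<gamma> * \<delta>1 + \<delta>2) / 2 * (norm (x - z))\<^sup>2 + L / 6 * norm (x - z) ^ 3"

(* The sequences x, xhat, ghat, Hhat (iteration, then node) form a run of the method for
   the iterations k = 0, ..., N. The bound N is an integer: N = -1 means that no iteration is made.
   sx, sg, sH and Tx, Tg, TH are the starting positions and the numbers of rounds of the three
   consensus phases of each iteration. *)
definition decentralized_cubic_newton ::
    "(nat \<Rightarrow> real^'m^'m) \<Rightarrow> ('m \<Rightarrow> real^'d \<Rightarrow> real^'d) \<Rightarrow> ('m \<Rightarrow> real^'d \<Rightarrow> real^'d^'d)
      \<Rightarrow> real \<Rightarrow> real \<Rightarrow> (nat \<Rightarrow> real) \<Rightarrow> (nat \<Rightarrow> real)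
      \<Rightarrow> (nat \<Rightarrow> nat) \<Rightarrow> (nat \<Rightarrow> nat) \<Rightarrow> (nat \<Rightarrow> nat) \<Rightarrow> (nat \<Rightarrow> nat) \<Rightarrow> (nat \<Rightarrow> nat) \<Rightarrow> (nat \<Rightarrow> nat)
      \<Rightarrow> int \<Rightarrow> (nat \<Rightarrow> 'm \<Rightarrow> real^'d) \<Rightarrow> (nat \<Rightarrow> 'm \<Rightarrow> real^'d)
      \<Rightarrow> (nat \<Rightarrow> 'm \<Rightarrow> real^'d) \<Rightarrow> (nat \<Rightarrow> 'm \<Rightarrow> real^'d^'d) \<Rightarrow> bool" where
  "decentralized_cubic_newton W grad hess L \<gamma> \<delta>1 \<delta>2 sx Tx sg Tg sH TH N x xhat ghat Hhat \<longleftrightarrow>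
     (\<forall>k i. int k \<le> N \<longrightarrow>
        xhat k i = consensus W (sx k) (Tx k) (\<lambda>j. x k j) i \<and>
        ghat k i = consensus W (sg k) (Tg k) (\<lambda>j. grad j (xhat k j)) i \<and>
        Hhat k i = unflatten (consensus W (sH k) (TH k) (\<lambda>j. flatten (hess j (xhat k j))) i) \<and>
        is_arg_min (cubic_model L \<gamma> (\<delta>1 k) (\<delta>2 k) (ghat k i) (Hhat k i) (xhat k i))
          (\<lambda>_. True) (x (Suc k) i))"

definition inexactness_levels ::
    "('m::finite \<Rightarrow> real^'d \<Rightarrow> real^'d) \<Rightarrow> ('m \<Rightarrow> real^'d \<Rightarrow> real^'d^'d) \<Rightarrow> int
      \<Rightarrow> (nat \<Rightarrow> 'm \<Rightarrow> real^'d) \<Rightarrow> (nat \<Rightarrow> 'm \<Rightarrow> real^'d)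
      \<Rightarrow> (nat \<Rightarrow> 'm \<Rightarrow> real^'d) \<Rightarrow> (nat \<Rightarrow> 'm \<Rightarrow> real^'d^'d)
      \<Rightarrow> (nat \<Rightarrow> real) \<Rightarrow> (nat \<Rightarrow> real) \<Rightarrow> (nat \<Rightarrow> real) \<Rightarrow> bool" where
  "inexactness_levels grad hess N x xhat ghat Hhat \<Delta>x \<Delta>g \<Delta>H \<longleftrightarrow>
     (\<forall>k. int k \<le> N \<longrightarrow>
        (MAX i. norm (xhat k i - mean (x k))) \<le> \<Delta>x k \<and>
        (MAX i. norm (ghat k i - mean (\<lambda>j. grad j (xhat k j)))) \<le> \<Delta>g k \<and>
        (MAX i. opnorm (Hhat k i - mean (\<lambda>j. hess j (xhat k j)))) \<le> \<Delta>H k)"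

end

theory Submission
  imports Defs
begin

text \<open>
  Each node minimizes a cubic model of \<open>f\<close> built at its own estimate
  \<open>z\<close> of the mean iterate, from a gradient and a Hessian that are both inexact.
  If the errors are at most \<open>\<delta>1\<close> and \<open>\<delta>2\<close>, then the cubic Taylor bound together
  with Young's inequality \<open>\<delta>1 r \<le> \<delta>1 / (2 \<gamma>) + \<gamma> \<delta>1 r\<^sup>2 / 2\<close> shows that,
  for \<open>K \<le> L\<close> with \<open>K\<close> the Lipschitz constant of the Hessian, \<open>f\<close> differs from the
  inexact quadratic model by at most the regularization terms (\<open>inexact_cubic_taylor\<close>).
  Hence the regularized model majorizes \<open>f\<close>, and its minimizer \<open>w\<close>
  satisfies, for every \<open>y\<close>,
  \<open>f w \<le> f y + \<delta>1 / \<gamma> + (\<gamma> \<delta>1 + \<delta>2) r\<^sup>2 + (L + K) r\<^sup>3 / 6\<close>, where \<open>r\<close> is the distance from \<open>y\<close> to \<open>z\<close>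
  (\<open>cubic_step_le\<close>).

  The test point is \<open>y = c + \<alpha> (xstar - c)\<close>, where \<open>c\<close> is the mean iterate. Since \<open>z\<close> is close to
  \<open>c\<close>, the powers of \<open>r\<close> split into powers of \<open>\<alpha> R\<close>, with \<open>R\<close> the distance from \<open>c\<close> to
  \<open>xstar\<close>, and powers of the consensus error. Strong convexity provides a term \<open>- \<mu> \<alpha> R\<^sup>2 / 4\<close>. Half of it
  absorbs \<open>(\<alpha> R)\<^sup>2\<close>, because the upper bounds on \<open>\<delta>1\<close> and \<open>\<delta>2\<close> give \<open>\<gamma> \<delta>1 + \<delta>2 \<le> \<mu> / 8\<close>; the other half
  absorbs \<open>(\<alpha> R)\<^sup>3\<close> as long as \<open>R \<le> D\<close>, which is what the value of \<open>\<alpha>\<close> is made for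
  (\<open>cubic_step_contraction\<close>). The remaining terms come from the inexactness alone, and the
  prescribed levels make each of the three at most \<open>\<alpha> \<epsilon> / 6\<close> (\<open>inexactness_budget\<close>). Averaging over the
  nodes with Jensen's inequality yields, for the gap \<open>e k\<close> between the value of \<open>f\<close> at the mean
  iterate and its minimum, \<open>e (k + 1) \<le> (1 - \<alpha>) e k + \<alpha> \<epsilon> / 2\<close>.

  This recursion never raises the gap above \<open>e 0 + \<epsilon>\<close>, so the mean iterates stay in the sublevel set
  whose radius is \<open>D\<close>, which is the hypothesis under which the recursion was derived. Its fixed point
  is \<open>\<epsilon> / 2\<close>, and the number of iterations is such that the geometric part also falls
  below \<open>\<epsilon> / 2\<close>.

  The lower bounds on \<open>\<delta>1\<close> and \<open>\<delta>2\<close> make them cover the actual errors: a node receives an average of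
  gradients or Hessians taken at the estimates of the other nodes, and replacing these by its own
  estimate costs at most twice the error of the estimates times the mean Lipschitz constant (\<open>inexact_mean_le\<close>).
\<close>

section \<open>Averages over the nodes\<close>

lemma linear_mean: "linear T \<Longrightarrow> T (mean u) = mean (\<lambda>i. T (u i))"
  by (simp add: mean_def linear_scale linear_sum)

lemma mean_const [simp]: "mean (\<lambda>_::'m::finite. c) = c"
  by (simp add: mean_def sum_constant_scaleR)

lemma mean_add: "mean (\<lambda>i. u i + v i) = mean u + mean v"
  by (simp add: mean_def sum.distrib scaleR_add_right)

lemma mean_diff: "mean (\<lambda>i. u i - v i) = mean u - mean v"
  by (simp add: mean_def sum_subtractf scaleR_diff_right)

lemma mean_mult_left: "mean (\<lambda>i. (c::real) * u i) = c * mean u"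
  by (simp add: mean_def flip: sum_distrib_left)

lemma mean_mult_right: "mean (\<lambda>i. u i * (c::real)) = mean u * c"
  by (simp add: mean_def flip: sum_distrib_right)

lemma mean_mono: "(\<And>i. u i \<le> (v i :: real)) \<Longrightarrow> mean u \<le> mean v"
  by (simp add: mean_def divide_right_mono sum_mono)

lemma mean_nonneg: "(\<And>i. 0 \<le> (u i :: real)) \<Longrightarrow> 0 \<le> mean u"
  by (simp add: mean_def sum_nonneg)

lemma mean_pos: "(\<And>i. 0 < (u i :: real)) \<Longrightarrow> 0 < mean u"
  by (simp add: mean_def sum_pos)

lemma norm_mean_le: "norm (mean u) \<le> mean (\<lambda>i. norm (u i))"
  by (simp add: mean_def divide_right_mono norm_sum)

lemma has_derivative_mean:
  assumes "\<And>i. (u i has_derivative u' i) F"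
  shows "((\<lambda>z. mean (\<lambda>i. u i z)) has_derivative (\<lambda>h. mean (\<lambda>i. u' i h))) F"
  unfolding mean_def using assms by (intro has_derivative_scaleR_right has_derivative_sum)

lemma GDERIV_mean:
  assumes "\<And>i. GDERIV (u i) z :> g i"
  shows "GDERIV (\<lambda>z. mean (\<lambda>i. u i z)) z :> mean g"
proof -
  have "h \<bullet> mean g = mean (\<lambda>i. h \<bullet> g i)" for h
    by (rule linear_mean) (simp add: bounded_linear.linear bounded_linear_inner_right)
  then show ?thesis
    using has_derivative_mean[of u "\<lambda>i h. h \<bullet> g i" "at z"] assms
    by (simp add: gderiv_def)
qed

lemma mean_matrix_vector_mult:
  fixes A :: "'m::finite \<Rightarrow> real^'n^'k"
  shows "mean A *v v = mean (\<lambda>i. A i *v v)"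
  by (rule linear_mean[where T = "\<lambda>A. A *v v"])
     (auto intro!: linearI simp: matrix_vector_mult_add_rdistrib scaleR_matrix_vector_assoc)

section \<open>Strong convexity\<close>

lemma strongly_convexD:
  assumes "strongly_convex \<mu> f" "0 \<le> t" "t \<le> 1"
  shows "f ((1 - t) *\<^sub>R x + t *\<^sub>R y)
       \<le> (1 - t) * f x + t * f y - \<mu> / 2 * (t * (1 - t)) * (norm (x - y))\<^sup>2"
  using assms unfolding strongly_convex_def by simp

lemma strongly_convex_mean:
  fixes u :: "'m::finite \<Rightarrow> 'a::real_normed_vector \<Rightarrow> real"
  assumes "\<And>i. strongly_convex (\<mu> i) (u i)"
  shows "strongly_convex (mean \<mu>) (\<lambda>z. mean (\<lambda>i. u i z))"
  unfolding strongly_convex_def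
proof (intro allI ballI)
  fix x y :: 'a and t :: real assume t: "t \<in> {0..1}"
  have "mean (\<lambda>i. u i ((1 - t) *\<^sub>R x + t *\<^sub>R y))
      \<le> mean (\<lambda>i. (1 - t) * u i x + t * u i y - \<mu> i * ((t * (1 - t)) * (norm (x - y))\<^sup>2 / 2))"
    using strongly_convexD[OF assms] t by (intro mean_mono) (fastforce simp: field_simps)
  also have "\<dots> = (1 - t) * mean (\<lambda>i. u i x) + t * mean (\<lambda>i. u i y)
      - mean \<mu> * ((t * (1 - t)) * (norm (x - y))\<^sup>2 / 2)"
    by (simp only: mean_diff mean_add mean_mult_left mean_mult_right)
  finally show "mean (\<lambda>i. u i ((1 - t) *\<^sub>R x + t *\<^sub>R y)) \<le> (1 - t) * mean (\<lambda>i. u i x)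
      + t * mean (\<lambda>i. u i y) - mean \<mu> / 2 * (t * (1 - t)) * (norm (x - y))\<^sup>2"
    by (simp add: mult_ac)
qed

lemma strongly_convex_imp_convex_on:
  fixes f :: "'a::real_normed_vector \<Rightarrow> real"
  assumes "strongly_convex \<mu> f" "0 \<le> \<mu>"
  shows "convex_on UNIV f"
proof (rule convex_onI)
  fix t :: real and x y :: 'a
  assume "0 < t" "t < 1"
  moreover from this assms(2) have "0 \<le> \<mu> / 2 * (t * (1 - t)) * (norm (x - y))\<^sup>2" by simp
  ultimately show "f ((1 - t) *\<^sub>R x + t *\<^sub>R y) \<le> (1 - t) * f x + t * f y"
    using strongly_convexD[OF assms(1), of t x y] by linarith
qed simp

lemma convex_on_mean_le:
  fixes u :: "'m::finite \<Rightarrow> 'a::real_vector"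
  assumes "convex_on UNIV f"
  shows "f (mean u) \<le> mean (\<lambda>i. f (u i))"
  using convex_on_sum[OF _ _ assms, of UNIV "\<lambda>_. 1 / real CARD('m)" u]
  by (simp add: mean_def scaleR_sum_right sum_distrib_left)

text \<open>
  The midpoint of \<open>xstar\<close> and \<open>z\<close> has at least the minimal value. The constant is half the
  optimal one, which is enough to make sublevel sets bounded.
\<close>
lemma strongly_convex_quadratic_growth:
  assumes "strongly_convex \<mu> f" "is_arg_min f (\<lambda>_. True) xstar"
  shows "\<mu> / 4 * (norm (z - xstar))\<^sup>2 \<le> f z - f xstar"
proof -
  have "f xstar \<le> f ((1 - 1/2) *\<^sub>R xstar + (1/2) *\<^sub>R z)"
    using assms(2) by (simp add: is_arg_min_linorder)
  also have "\<dots> \<le> (1 - 1/2) * f xstar + 1/2 * f z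
      - \<mu> / 2 * (1/2 * (1 - 1/2)) * (norm (xstar - z))\<^sup>2"
    by (rule strongly_convexD[OF assms(1)]) auto
  finally show ?thesis by (simp add: norm_minus_commute)
qed

text \<open>
  The greatest element is an unspecified value unless the maximum is attained. It is attained here because
  the sublevel set is compact: closed by continuity, bounded by quadratic growth. The
  radius is positive because a strict sublevel set of a continuous function is open.
\<close>
lemma sublevel_radius_attained:
  fixes f :: "'a::euclidean_space \<Rightarrow> real"
  assumes sc: "strongly_convex \<mu> f" and "\<mu> > 0"
    and cont: "continuous_on UNIV f"
    and min: "is_arg_min f (\<lambda>_. True) xstar"
    and c: "f xstar < c"
    and D: "D = (GREATEST r. \<exists>z. f z \<le> c \<and> r = norm (z - xstar))"
  shows "\<And>z. f z \<le> c \<Longrightarrow> norm (z - xstar) \<le> D" and "D > 0"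
proof -
  let ?S = "{z. f z \<le> c}"
  have bd: "norm (z - xstar) \<le> sqrt (4 * (c - f xstar) / \<mu>)" if "z \<in> ?S" for z
  proof (rule real_le_rsqrt)
    show "(norm (z - xstar))\<^sup>2 \<le> 4 * (c - f xstar) / \<mu>"
      using strongly_convex_quadratic_growth[OF sc min, of z] that \<open>\<mu> > 0\<close>
      by (simp add: field_simps)
  qed
  have "bounded ?S"
    unfolding bounded_def using bd
    by (intro exI[of _ xstar] exI) (auto simp: dist_norm norm_minus_commute)
  moreover have "closed ?S"
    using cont by (intro closed_Collect_le) auto
  ultimately have "compact ?S" by (simp add: compact_eq_bounded_closed)
  moreover have "xstar \<in> ?S" using c by simp
  ultimately obtain w where w: "w \<in> ?S" "\<And>z. z \<in> ?S \<Longrightarrow> norm (z - xstar) \<le> norm (w - xstar)"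
    using continuous_attains_sup[of ?S "\<lambda>z. norm (z - xstar)"]
    by (force intro: continuous_intros)
  have "D = norm (w - xstar)"
    unfolding D using w by (intro Greatest_equality) auto
  with w(2) show *: "norm (z - xstar) \<le> D" if "f z \<le> c" for z
    using that by simp
  have "open {z. f z < c}"
    using cont by (intro open_Collect_less) auto
  then obtain e where e: "e > 0" "ball xstar e \<subseteq> {z. f z < c}"
    using c by (auto simp: open_contains_ball)
  obtain b :: 'a where b: "b \<in> Basis" using nonempty_Basis by blast
  let ?y = "xstar + (e / 2) *\<^sub>R b"
  have "?y \<in> ball xstar e" using e b by (simp add: dist_norm)
  with e have "f ?y \<le> c" by force
  from *[OF this] show "D > 0" using e b by simp
qed

section \<open>Second-order Taylor estimates\<close>

text \<open>
  Subtracting the Taylor polynomial and the cubic remainder leaves a function whose derivative vanishes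
  at 0 and is nonincreasing on the unit interval. The one-sided version suffices, since the
  lower estimate is the upper one for the negated function.
\<close>
lemma cubic_taylor_upper_real:
  fixes p p' p'' :: "real \<Rightarrow> real"
  assumes p: "\<And>t. (p has_real_derivative p' t) (at t)"
    and p': "\<And>t. (p' has_real_derivative p'' t) (at t)"
    and M: "\<And>t. 0 \<le> t \<Longrightarrow> t \<le> 1 \<Longrightarrow> p'' t - p'' 0 \<le> M * t"
  shows "p 1 \<le> p 0 + p' 0 + p'' 0 / 2 + M / 6"
proof -
  let ?q = "\<lambda>t. p t - t * p' 0 - t\<^sup>2 / 2 * p'' 0 - M / 6 * t ^ 3"
  let ?q' = "\<lambda>t. p' t - p' 0 - t * p'' 0 - M / 2 * t\<^sup>2"
  have q'_nonpos: "?q' t \<le> 0" if "0 \<le> t" "t \<le> 1" for t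
  proof -
    have "?q' t \<le> ?q' 0"
    proof (rule DERIV_nonpos_imp_nonincreasing[OF \<open>0 \<le> t\<close>], intro exI conjI)
      fix s assume "0 \<le> s" "s \<le> t"
      show "(?q' has_real_derivative p'' s - p'' 0 - M * s) (at s)"
        by (auto intro!: derivative_eq_intros p')
      show "p'' s - p'' 0 - M * s \<le> 0" using M[of s] \<open>0 \<le> s\<close> \<open>s \<le> t\<close> \<open>t \<le> 1\<close> by simp
    qed
    then show ?thesis by simp
  qed
  have "?q 1 \<le> ?q 0"
  proof (rule DERIV_nonpos_imp_nonincreasing[OF zero_le_one], intro exI conjI)
    fix t :: real assume "0 \<le> t" "t \<le> 1"
    show "(?q has_real_derivative ?q' t) (at t)"
      by (auto intro!: derivative_eq_intros p simp: field_simps)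
    show "?q' t \<le> 0" using q'_nonpos \<open>0 \<le> t\<close> \<open>t \<le> 1\<close> .
  qed
  then show ?thesis by simp
qed

lemma norm_matrix_vector_le: "norm (A *v v) \<le> opnorm A * norm v"
  using onorm[of "\<lambda>v. A *v v" v] by simp

lemma cubic_taylor:
  fixes f :: "real^'d \<Rightarrow> real"
  assumes G: "\<And>z. GDERIV f z :> G z"
    and H: "\<And>z. (G has_derivative (\<lambda>h. H z *v h)) (at z)"
    and lip: "\<And>y z v. norm ((H y - H z) *v v) \<le> K * norm (y - z) * norm v"
  shows "\<bar>f y - (f z + G z \<bullet> (y - z) + 1 / 2 * ((H z *v (y - z)) \<bullet> (y - z)))\<bar>
      \<le> K / 6 * norm (y - z) ^ 3"
proof -
  let ?h = "y - z"
  let ?p = "\<lambda>t. f (z + t *\<^sub>R ?h)"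
  let ?p' = "\<lambda>t. G (z + t *\<^sub>R ?h) \<bullet> ?h"
  let ?p'' = "\<lambda>t. (H (z + t *\<^sub>R ?h) *v ?h) \<bullet> ?h"
  let ?M = "K * norm ?h ^ 3"
  have line: "((\<lambda>t. z + t *\<^sub>R ?h) has_derivative (\<lambda>s. s *\<^sub>R ?h)) (at t)" for t
    by (auto intro!: derivative_eq_intros)
  have p: "(?p has_real_derivative ?p' t) (at t)" for t
  proof -
    have "(f has_derivative (\<lambda>h. h \<bullet> G (z + t *\<^sub>R ?h))) (at (z + t *\<^sub>R ?h))"
      using G by (simp add: gderiv_def)
    from has_derivative_compose[OF line this] show ?thesis
      by (rule has_derivative_imp_has_field_derivative) (simp add: inner_commute)
  qed
  have p': "(?p' has_real_derivative ?p'' t) (at t)" for t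
  proof -
    have "((\<lambda>t. G (z + t *\<^sub>R ?h)) has_derivative (\<lambda>s. H (z + t *\<^sub>R ?h) *v (s *\<^sub>R ?h))) (at t)"
      by (rule has_derivative_compose[OF line H])
    then have "(?p' has_derivative (\<lambda>s. (H (z + t *\<^sub>R ?h) *v (s *\<^sub>R ?h)) \<bullet> ?h)) (at t)"
      by (rule has_derivative_inner_left)
    then show ?thesis
      by (rule has_derivative_imp_has_field_derivative) (simp add: matrix_vector_mult_scaleR)
  qed
  have M: "\<bar>?p'' t - ?p'' 0\<bar> \<le> ?M * t" if "0 \<le> t" for t
  proof -
    have "\<bar>?p'' t - ?p'' 0\<bar> = \<bar>((H (z + t *\<^sub>R ?h) - H z) *v ?h) \<bullet> ?h\<bar>"
      by (simp add: matrix_vector_mult_diff_rdistrib inner_diff_left)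
    also have "\<dots> \<le> norm ((H (z + t *\<^sub>R ?h) - H z) *v ?h) * norm ?h"
      by (rule Cauchy_Schwarz_ineq2)
    also have "\<dots> \<le> (K * norm (z + t *\<^sub>R ?h - z) * norm ?h) * norm ?h"
      by (rule mult_right_mono[OF lip]) simp
    also have "\<dots> = ?M * t" using that by (simp add: power3_eq_cube mult_ac)
    finally show ?thesis .
  qed
  have "?p 1 \<le> ?p 0 + ?p' 0 + ?p'' 0 / 2 + ?M / 6"
  proof (rule cubic_taylor_upper_real[of ?p ?p' ?p''])
    show "?p'' t - ?p'' 0 \<le> ?M * t" if "0 \<le> t" for t using M[OF that] by linarith
  qed (rule p p')+
  moreover have "- ?p 1 \<le> - ?p 0 + - ?p' 0 + - ?p'' 0 / 2 + ?M / 6"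
  proof (rule cubic_taylor_upper_real[of "\<lambda>t. - ?p t" "\<lambda>t. - ?p' t" "\<lambda>t. - ?p'' t"])
    show "- ?p'' t - - ?p'' 0 \<le> ?M * t" if "0 \<le> t" for t using M[OF that] by linarith
  qed (rule DERIV_minus p p')+
  ultimately show ?thesis by (intro abs_leI) simp_all
qed

section \<open>One inexact cubic step\<close>

text \<open>
  The first-order error \<open>\<delta>1 r\<close> is linear in the distance, whereas the model has only a constant, a
  quadratic and a cubic regularization term. Young's inequality with weight
  \<open>\<gamma>\<close> trades the linear term for a constant and a quadratic one.
\<close>
lemma inexact_cubic_taylor:
  fixes f :: "real^'d \<Rightarrow> real"
  assumes G: "\<And>z. GDERIV f z :> G z"
    and H: "\<And>z. (G has_derivative (\<lambda>h. H z *v h)) (at z)"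
    and lip: "\<And>y z v. norm ((H y - H z) *v v) \<le> K * norm (y - z) * norm v"
    and g: "norm (g - G z) \<le> \<delta>1"
    and B: "\<And>v. norm ((B - H z) *v v) \<le> \<delta>2 * norm v"
    and \<gamma>: "\<gamma> > 0"
  shows "\<bar>f y - (f z + g \<bullet> (y - z) + 1 / 2 * ((B *v (y - z)) \<bullet> (y - z)))\<bar>
      \<le> \<delta>1 / (2 * \<gamma>) + (\<gamma> * \<delta>1 + \<delta>2) / 2 * (norm (y - z))\<^sup>2 + K / 6 * norm (y - z) ^ 3"
proof -
  let ?h = "y - z"
  have "\<bar>(g - G z) \<bullet> ?h\<bar> \<le> norm (g - G z) * norm ?h" by (rule Cauchy_Schwarz_ineq2)
  also have "\<dots> \<le> \<delta>1 * norm ?h" using g by (rule mult_right_mono) simp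
  also have "\<dots> \<le> \<delta>1 * (1 / (2 * \<gamma>) + \<gamma> / 2 * (norm ?h)\<^sup>2)"
  proof (rule mult_left_mono)
    have "0 \<le> (\<gamma> * norm ?h - 1)\<^sup>2 / (2 * \<gamma>)" using \<gamma> by simp
    also have "\<dots> = 1 / (2 * \<gamma>) + \<gamma> / 2 * (norm ?h)\<^sup>2 - norm ?h"
      using \<gamma> by (simp add: field_simps power2_eq_square)
    finally show "norm ?h \<le> 1 / (2 * \<gamma>) + \<gamma> / 2 * (norm ?h)\<^sup>2" by simp
    show "0 \<le> \<delta>1" using g norm_ge_zero[of "g - G z"] by linarith
  qed
  finally have e1: "\<bar>(g - G z) \<bullet> ?h\<bar> \<le> \<delta>1 / (2 * \<gamma>) + \<gamma> * \<delta>1 / 2 * (norm ?h)\<^sup>2"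
    by (simp add: algebra_simps)
  have "\<bar>((B - H z) *v ?h) \<bullet> ?h\<bar> \<le> norm ((B - H z) *v ?h) * norm ?h"
    by (rule Cauchy_Schwarz_ineq2)
  also have "\<dots> \<le> (\<delta>2 * norm ?h) * norm ?h" using B by (rule mult_right_mono) simp
  finally have e2: "\<bar>((B - H z) *v ?h) \<bullet> ?h\<bar> \<le> \<delta>2 * (norm ?h)\<^sup>2"
    by (simp add: power2_eq_square mult_ac)
  have d1: "(g - G z) \<bullet> ?h = g \<bullet> ?h - G z \<bullet> ?h" by (rule inner_diff_left)
  have d2: "((B - H z) *v ?h) \<bullet> ?h = (B *v ?h) \<bullet> ?h - (H z *v ?h) \<bullet> ?h"
    by (simp only: matrix_vector_mult_diff_rdistrib inner_diff_left)
  have d3: "(\<gamma> * \<delta>1 + \<delta>2) / 2 * (norm ?h)\<^sup>2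
      = \<gamma> * \<delta>1 / 2 * (norm ?h)\<^sup>2 + 1 / 2 * (\<delta>2 * (norm ?h)\<^sup>2)"
    by (simp add: field_simps)
  show ?thesis
    using cubic_taylor[OF G H lip, of y z] e1 e2 unfolding d1 d2 d3 by linarith
qed

text \<open>
  The two-sided Taylor estimate is used twice: at \<open>w\<close> the model lies above \<open>f\<close>, and at \<open>y\<close> the model
  exceeds \<open>f\<close> by at most the regularization plus the same error once more, which explains the doubling of
  the \<open>\<delta>1\<close> and \<open>\<delta>2\<close> terms and the sum \<open>L + K\<close>.
\<close>
lemma cubic_step_le:
  fixes f :: "real^'d \<Rightarrow> real"
  assumes G: "\<And>z. GDERIV f z :> G z"
    and H: "\<And>z. (G has_derivative (\<lambda>h. H z *v h)) (at z)"
    and lip: "\<And>y z v. norm ((H y - H z) *v v) \<le> K * norm (y - z) * norm v"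
    and g: "norm (g - G z) \<le> \<delta>1"
    and B: "\<And>v. norm ((B - H z) *v v) \<le> \<delta>2 * norm v"
    and \<gamma>: "\<gamma> > 0"
    and KL: "K \<le> L"
    and step: "is_arg_min (cubic_model L \<gamma> \<delta>1 \<delta>2 g B z) (\<lambda>_. True) w"
  shows "f w \<le> f y + \<delta>1 / \<gamma> + (\<gamma> * \<delta>1 + \<delta>2) * (norm (y - z))\<^sup>2 + (L + K) / 6 * norm (y - z) ^ 3"
proof -
  note taylor = inexact_cubic_taylor[OF G H lip g B \<gamma>]
  let ?m = "cubic_model L \<gamma> \<delta>1 \<delta>2 g B z"
  have "K / 6 * norm (w - z) ^ 3 \<le> L / 6 * norm (w - z) ^ 3"
    using KL by (intro mult_right_mono) auto
  with taylor[of w] have "f w \<le> f z + ?m w"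
    unfolding cubic_model_def by linarith
  also have "\<dots> \<le> f z + ?m y" using step by (simp add: is_arg_min_linorder)
  also have "\<dots> \<le> f y + \<delta>1 / \<gamma> + (\<gamma> * \<delta>1 + \<delta>2) * (norm (y - z))\<^sup>2
      + (L + K) / 6 * norm (y - z) ^ 3"
  proof -
    have "(L + K) / 6 * norm (y - z) ^ 3 = L / 6 * norm (y - z) ^ 3 + K / 6 * norm (y - z) ^ 3"
      by (simp add: field_simps)
    moreover have "(\<gamma> * \<delta>1 + \<delta>2) * (norm (y - z))\<^sup>2 = 2 * ((\<gamma> * \<delta>1 + \<delta>2) / 2 * (norm (y - z))\<^sup>2)"
      by simp
    moreover have "\<delta>1 / \<gamma> = 2 * (\<delta>1 / (2 * \<gamma>))" by simp
    ultimately show ?thesis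
      using taylor[of y] unfolding cubic_model_def by linarith
  qed
  finally show ?thesis .
qed

text \<open>
  The point \<open>y\<close> of the step inequality is chosen at the fraction \<open>\<alpha>\<close> of the way from the reference
  point \<open>c\<close> to the minimizer. The conditions on \<open>\<alpha>\<close> and \<open>q\<close> let the strong convexity gain absorb everything
  that depends on the distance from \<open>c\<close> to the minimizer.
\<close>
lemma cubic_step_contraction:
  fixes f :: "'a::real_inner \<Rightarrow> real"
  assumes sc: "strongly_convex \<mu> f" and "\<mu> \<ge> 0"
    and step: "\<And>y. f w \<le> f y + e + q * (norm (y - z))\<^sup>2 + M / 6 * norm (y - z) ^ 3"
    and "q \<ge> 0" "M \<ge> 0"
    and z: "norm (z - c) \<le> \<Delta>"
    and R: "norm (c - xstar) \<le> D"
    and \<alpha>: "0 \<le> \<alpha>" "\<alpha> \<le> 1 / 2" "16 * M * D * \<alpha>\<^sup>2 \<le> 3 * \<mu>"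
    and q: "q \<le> \<mu> / 8"
  shows "f w - f xstar \<le> (1 - \<alpha>) * (f c - f xstar) + (e + 2 * q * \<Delta>\<^sup>2 + 2 / 3 * M * \<Delta> ^ 3)"
proof -
  define y where "y = (1 - \<alpha>) *\<^sub>R c + \<alpha> *\<^sub>R xstar"
  define r where "r = norm (c - xstar)"
  have r: "0 \<le> r" "r \<le> D" using R by (auto simp: r_def)
  have \<Delta>: "0 \<le> \<Delta>" using z norm_ge_zero[of "z - c"] by linarith
  have fy: "f y \<le> (1 - \<alpha>) * f c + \<alpha> * f xstar - \<mu> / 2 * (\<alpha> * (1 - \<alpha>)) * r\<^sup>2"
    unfolding y_def r_def by (rule strongly_convexD[OF sc]) (use \<alpha> in auto)
  have "norm (y - z) = norm (\<alpha> *\<^sub>R (xstar - c) + (c - z))"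
    by (simp add: y_def algebra_simps)
  also have "\<dots> \<le> \<alpha> * r + \<Delta>"
    using \<alpha> z by (intro norm_triangle_le) (simp add: r_def norm_minus_commute)
  finally have yz: "norm (y - z) \<le> \<alpha> * r + \<Delta>" .
  have a: "0 \<le> \<alpha> * r" using \<alpha> r by simp
  have "(norm (y - z))\<^sup>2 \<le> (\<alpha> * r + \<Delta>)\<^sup>2" by (rule power_mono[OF yz]) simp
  also have "\<dots> \<le> 2 * (\<alpha> * r)\<^sup>2 + 2 * \<Delta>\<^sup>2"
    using sum_squares_bound[of "\<alpha> * r" \<Delta>] by (simp add: power2_sum)
  finally have "q * (norm (y - z))\<^sup>2 \<le> q * (2 * (\<alpha> * r)\<^sup>2 + 2 * \<Delta>\<^sup>2)"
    using \<open>q \<ge> 0\<close> by (rule mult_left_mono)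
  then have sq: "q * (norm (y - z))\<^sup>2 \<le> q * (2 * (\<alpha> * r)\<^sup>2) + 2 * q * \<Delta>\<^sup>2"
    by (simp add: distrib_left)
  have "norm (y - z) ^ 3 \<le> (\<alpha> * r + \<Delta>) ^ 3" by (rule power_mono[OF yz]) simp
  also have "\<dots> \<le> 4 * (\<alpha> * r) ^ 3 + 4 * \<Delta> ^ 3"
  proof -
    \<comment> \<open>the difference of the two sides\<close>
    have "0 \<le> 3 * (\<alpha> * r + \<Delta>) * (\<alpha> * r - \<Delta>)\<^sup>2" using a \<Delta> by simp
    then show ?thesis by (simp add: power2_eq_square power3_eq_cube algebra_simps)
  qed
  finally have "M / 6 * norm (y - z) ^ 3 \<le> M / 6 * (4 * (\<alpha> * r) ^ 3 + 4 * \<Delta> ^ 3)"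
    using \<open>M \<ge> 0\<close> by (intro mult_left_mono) auto
  then have cu: "M / 6 * norm (y - z) ^ 3 \<le> M / 6 * (4 * (\<alpha> * r) ^ 3) + 2 / 3 * M * \<Delta> ^ 3"
    by (simp add: distrib_left)
  \<comment> \<open>Half of the strong convexity gain pays for the quadratic term, half for the cubic one.\<close>
  have conv: "\<mu> / 4 * (\<alpha> * r\<^sup>2) \<le> \<mu> / 2 * (\<alpha> * (1 - \<alpha>)) * r\<^sup>2"
  proof -
    have "\<mu> / 2 * (1/2) * (\<alpha> * r\<^sup>2) \<le> \<mu> / 2 * (1 - \<alpha>) * (\<alpha> * r\<^sup>2)"
      using \<alpha> \<open>\<mu> \<ge> 0\<close> by (intro mult_right_mono mult_left_mono) auto
    then show ?thesis by (simp add: mult_ac)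
  qed
  have quad: "q * (2 * (\<alpha> * r)\<^sup>2) \<le> \<mu> / 8 * (\<alpha> * r\<^sup>2)"
  proof -
    have "q * (2 * \<alpha>) \<le> \<mu> / 8 * 1"
      using q \<alpha> \<open>q \<ge> 0\<close> \<open>\<mu> \<ge> 0\<close> by (intro mult_mono) auto
    then have "q * (2 * \<alpha>) * (\<alpha> * r\<^sup>2) \<le> \<mu> / 8 * 1 * (\<alpha> * r\<^sup>2)"
      using \<alpha> by (intro mult_right_mono) auto
    then show ?thesis by (simp add: power2_eq_square mult_ac)
  qed
  have cube: "M / 6 * (4 * (\<alpha> * r) ^ 3) \<le> \<mu> / 8 * (\<alpha> * r\<^sup>2)"
  proof -
    have "16 * M * r * \<alpha>\<^sup>2 \<le> 16 * M * D * \<alpha>\<^sup>2"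
      using r \<open>M \<ge> 0\<close> by (intro mult_right_mono mult_left_mono) auto
    with \<alpha> have "16 * M * r * \<alpha>\<^sup>2 \<le> 3 * \<mu>" by linarith
    then have "(16 * M * r * \<alpha>\<^sup>2) * (\<alpha> * r\<^sup>2) \<le> (3 * \<mu>) * (\<alpha> * r\<^sup>2)"
      using \<alpha> by (intro mult_right_mono) auto
    then show ?thesis by (simp add: power2_eq_square power3_eq_cube mult_ac)
  qed
  have "f w \<le> (1 - \<alpha>) * f c + \<alpha> * f xstar + e + 2 * q * \<Delta>\<^sup>2 + 2 / 3 * M * \<Delta> ^ 3"
    using step[of y] fy sq cu conv quad cube by linarith
  then show ?thesis by (simp add: algebra_simps)
qed

section \<open>The choice of the inexactness levels\<close>

text \<open>
  The terms with \<open>\<delta>1 * D\<close>, \<open>\<Delta>\<^sup>2\<close> and \<open>\<Delta> ^ 3\<close> are each at most \<open>\<alpha> * \<epsilon> / 6\<close>. The denominator under the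
  square root is, up to the factor \<open>24 * D\<^sup>2 * K1\<close>, the bound on \<open>2 * (\<delta>1 / D + \<delta>2)\<close> that follows from the
  level \<open>\<alpha> * \<epsilon> / (24 * K1 * D)\<close>, so the product with \<open>\<Delta>\<^sup>2\<close> cancels exactly.

  When \<open>K1\<close> vanishes, the first bound on \<open>bx\<close> is a division by zero and no longer
  cancels that denominator, but then the numerator under the square root forces \<open>\<Delta> = 0\<close> and the quadratic
  term disappears.
\<close>
lemma inexactness_budget:
  fixes \<alpha> \<epsilon> D \<mu> \<Delta> bx bg \<delta>1 \<delta>2 K1 K2 M :: real
  assumes pos: "\<alpha> > 0" "\<epsilon> > 0" "D > 0" "\<mu> > 0" "M > 0" "K1 \<ge> 0" "K2 \<ge> 0"
    and bx1: "bx \<le> \<alpha> * \<epsilon> / (24 * K1 * D)"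
    and bx2: "\<Delta> \<le> root 3 (\<alpha> * \<epsilon> / (4 * M))"
    and bx3: "\<Delta> \<le> 2 * D * sqrt (\<alpha> * \<epsilon> * K1 / (3 * \<mu> * D\<^sup>2 * K1 + 4 * \<alpha> * \<epsilon> * (2 * K1 + D * K2)))"
    and bx4: "bx \<le> \<mu> / (64 * (K1 / D + K2))"
    and bg: "bg \<le> \<alpha> * \<epsilon> / (12 * D)" "bg \<le> \<mu> * D / 32"
    and \<Delta>: "0 \<le> \<Delta>"
    and \<delta>: "\<delta>1 \<le> bg + 2 * K1 * bx" "\<delta>2 \<le> \<mu> / 16 + 2 * K2 * bx"
  shows "\<delta>1 / D + \<delta>2 \<le> \<mu> / 8"
    and "\<delta>1 * D + 2 * (\<delta>1 / D + \<delta>2) * \<Delta>\<^sup>2 + 2 / 3 * M * \<Delta> ^ 3 \<le> \<alpha> * \<epsilon> / 2"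
proof -
  have b4: "(K1 / D + K2) * bx \<le> \<mu> / 64"
  proof (cases "K1 / D + K2 = 0")
    case False
    then have "K1 / D + K2 > 0" using pos by (simp add: order_less_le)
    then have "bx * (64 * (K1 / D + K2)) \<le> \<mu>"
      using bx4 by (subst (asm) pos_le_divide_eq) auto
    then show ?thesis by (simp add: mult_ac)
  qed (use pos in simp)
  have "\<delta>1 / D \<le> (\<mu> * D / 32 + 2 * K1 * bx) / D"
    using \<delta>(1) bg(2) pos by (intro divide_right_mono) auto
  also have "\<dots> = \<mu> / 32 + 2 * (K1 / D * bx)" using pos by (simp add: field_simps)
  finally have "\<delta>1 / D \<le> \<mu> / 32 + 2 * (K1 / D * bx)" .
  moreover have "K1 / D * bx + K2 * bx \<le> \<mu> / 64" using b4 by (simp only: distrib_right)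
  ultimately show "\<delta>1 / D + \<delta>2 \<le> \<mu> / 8" using \<delta>(2) by linarith
  have b1: "K1 * bx \<le> \<alpha> * \<epsilon> / (24 * D)"
  proof (cases "K1 = 0")
    case False
    then have "K1 > 0" using pos by simp
    then show ?thesis using bx1 pos by (simp add: field_simps)
  qed (use pos in simp)
  have \<delta>1: "\<delta>1 \<le> \<alpha> * \<epsilon> / (6 * D)"
  proof -
    have "\<delta>1 \<le> \<alpha> * \<epsilon> / (12 * D) + 2 * (\<alpha> * \<epsilon> / (24 * D))" using \<delta>(1) bg(1) b1 by linarith
    then show ?thesis by simp
  qed
  then have t1: "\<delta>1 * D \<le> \<alpha> * \<epsilon> / 6" using pos by (simp add: field_simps)
  have "\<Delta> ^ 3 \<le> (root 3 (\<alpha> * \<epsilon> / (4 * M))) ^ 3" using bx2 \<Delta> by (rule power_mono)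
  also have "\<dots> = \<alpha> * \<epsilon> / (4 * M)" using pos by (intro real_root_pow_pos2) auto
  finally have t3: "2 / 3 * M * \<Delta> ^ 3 \<le> \<alpha> * \<epsilon> / 6" using pos by (simp add: field_simps)
  have t2: "2 * (\<delta>1 / D + \<delta>2) * \<Delta>\<^sup>2 \<le> \<alpha> * \<epsilon> / 6"
  proof (cases "K1 = 0")
    case True
    then have "\<Delta> = 0" using bx3 \<Delta> by simp
    then show ?thesis using pos by simp
  next
    case False
    then have K1: "K1 > 0" using pos by simp
    define Q where "Q = 3 * \<mu> * D\<^sup>2 * K1 + 4 * \<alpha> * \<epsilon> * (2 * K1 + D * K2)"
    have Q: "Q > 0" unfolding Q_def using pos K1 by (intro add_pos_nonneg) auto
    have "\<Delta>\<^sup>2 \<le> (2 * D * sqrt (\<alpha> * \<epsilon> * K1 / Q))\<^sup>2"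
      using bx3 \<Delta> unfolding Q_def by (rule power_mono)
    also have "\<dots> = 4 * D\<^sup>2 * (\<alpha> * \<epsilon> * K1 / Q)"
      using pos Q by (simp add: power_mult_distrib)
    finally have \<Delta>2: "\<Delta>\<^sup>2 \<le> 4 * D\<^sup>2 * (\<alpha> * \<epsilon> * K1 / Q)" .
    have "\<delta>1 / D \<le> \<alpha> * \<epsilon> / (6 * D) / D" using \<delta>1 pos by (intro divide_right_mono) auto
    moreover have "\<delta>2 \<le> \<mu> / 16 + 2 * K2 * (\<alpha> * \<epsilon> / (24 * K1 * D))"
      using bx1 pos by (intro order_trans[OF \<delta>(2)] add_left_mono mult_left_mono) auto
    ultimately have "2 * (\<delta>1 / D + \<delta>2)
        \<le> 2 * (\<alpha> * \<epsilon> / (6 * D) / D + (\<mu> / 16 + 2 * K2 * (\<alpha> * \<epsilon> / (24 * K1 * D))))"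
      by (intro mult_left_mono add_mono) auto
    also have "\<dots> = Q / (24 * D\<^sup>2 * K1)"
      unfolding Q_def using pos K1 by (simp add: field_simps power2_eq_square)
    finally have "2 * (\<delta>1 / D + \<delta>2) * \<Delta>\<^sup>2 \<le> Q / (24 * D\<^sup>2 * K1) * \<Delta>\<^sup>2"
      by (rule mult_right_mono) simp
    also have "\<dots> \<le> Q / (24 * D\<^sup>2 * K1) * (4 * D\<^sup>2 * (\<alpha> * \<epsilon> * K1 / Q))"
      using \<Delta>2 Q K1 by (intro mult_left_mono) auto
    also have "\<dots> = \<alpha> * \<epsilon> / 6" using pos K1 Q by (simp add: field_simps)
    finally show ?thesis .
  qed
  show "\<delta>1 * D + 2 * (\<delta>1 / D + \<delta>2) * \<Delta>\<^sup>2 + 2 / 3 * M * \<Delta> ^ 3 \<le> \<alpha> * \<epsilon> / 2"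
    using t1 t2 t3 by linarith
qed

section \<open>Iterating the contraction\<close>

text \<open>
  The recursion is available only while the gap stays below \<open>e 0 + \<epsilon>\<close>; the closed form that it produces
  re-establishes this bound, so both are carried through one induction.
\<close>
lemma perturbed_contraction_iterate:
  fixes e :: "nat \<Rightarrow> real"
  assumes \<alpha>: "0 < \<alpha>" "\<alpha> \<le> 1" and e0: "0 \<le> e 0" and \<epsilon>: "0 \<le> \<epsilon>"
    and step: "\<And>k. k < n \<Longrightarrow> e k \<le> e 0 + \<epsilon> \<Longrightarrow> e (Suc k) \<le> (1 - \<alpha>) * e k + \<alpha> * \<epsilon> / 2"
  shows "k \<le> n \<Longrightarrow> e k \<le> (1 - \<alpha>) ^ k * e 0 + \<epsilon> / 2"
proof (induction k)
  case 0
  then show ?case using \<epsilon> by simp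
next
  case (Suc k)
  then have IH: "e k \<le> (1 - \<alpha>) ^ k * e 0 + \<epsilon> / 2" by simp
  have "(1 - \<alpha>) ^ k * e 0 \<le> 1 * e 0"
    using \<alpha> e0 by (intro mult_right_mono power_le_one) auto
  with IH \<epsilon> have "e k \<le> e 0 + \<epsilon>" by linarith
  with Suc.prems have "e (Suc k) \<le> (1 - \<alpha>) * e k + \<alpha> * \<epsilon> / 2" by (intro step) auto
  also have "\<dots> \<le> (1 - \<alpha>) * ((1 - \<alpha>) ^ k * e 0 + \<epsilon> / 2) + \<alpha> * \<epsilon> / 2"
    using IH \<alpha> by (intro add_right_mono mult_left_mono) auto
  also have "\<dots> = (1 - \<alpha>) ^ Suc k * e 0 + \<epsilon> / 2" by (simp add: field_simps)
  finally show ?case .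
qed

text \<open>
  From \<open>1 - \<alpha> \<le> exp (- \<alpha>)\<close>. A zero gap is treated apart, since the logarithm is then meaningless. A negative
  logarithm means that the initial gap is already below \<open>\<epsilon> / 2\<close>, and the truncation by
  \<^term>\<open>nat\<close> makes the iteration count 0.
\<close>
lemma contraction_iteration_count:
  fixes \<alpha> \<epsilon> e0 :: real
  assumes \<alpha>: "0 < \<alpha>" "\<alpha> \<le> 1" and \<epsilon>: "0 < \<epsilon>" and e0: "0 \<le> e0"
    and n: "n = nat \<lceil>1 / \<alpha> * ln (2 * e0 / \<epsilon>)\<rceil>"
  shows "(1 - \<alpha>) ^ n * e0 \<le> \<epsilon> / 2"
proof (cases "e0 = 0")
  case False
  then have e0: "e0 > 0" using e0 by simp
  have "1 / \<alpha> * ln (2 * e0 / \<epsilon>) \<le> real n" unfolding n by linarith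
  then have "ln (2 * e0 / \<epsilon>) \<le> real n * \<alpha>" using \<alpha> by (simp add: field_simps)
  then have "exp (ln (2 * e0 / \<epsilon>)) \<le> exp (real n * \<alpha>)" by simp
  then have "2 * e0 / \<epsilon> \<le> exp (real n * \<alpha>)" using e0 \<epsilon> by simp
  then have "e0 * exp (- (real n * \<alpha>)) \<le> \<epsilon> / 2"
    using \<epsilon> by (simp add: exp_minus field_simps)
  moreover have "(1 - \<alpha>) ^ n \<le> exp (- \<alpha>) ^ n"
    using \<alpha> exp_ge_add_one_self[of "- \<alpha>"] by (intro power_mono) auto
  then have "(1 - \<alpha>) ^ n * e0 \<le> exp (- (real n * \<alpha>)) * e0"
    using e0 by (simp add: exp_of_nat_mult[symmetric])
  ultimately show ?thesis by (simp add: mult.commute)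
qed (use \<epsilon> in simp)

section \<open>Consensus errors\<close>

text \<open>
  Node \<open>i\<close> receives an approximation \<open>w\<close> of the average of the \<open>F j\<close> at the different points \<open>v j\<close>, but
  its model needs the average at its own point \<open>v i\<close>. All points lie within \<open>\<Delta>\<close> of a common \<open>c\<close>, hence within
  \<open>2 * \<Delta>\<close> of each other.
\<close>
lemma inexact_mean_le:
  fixes F :: "'m::finite \<Rightarrow> 'a::real_normed_vector \<Rightarrow> 'b::real_normed_vector"
  assumes lip: "\<And>j y z. norm (F j y - F j z) \<le> K j * norm (y - z)" and K: "\<And>j. 0 \<le> K j"
    and near: "\<And>j. norm (v j - c) \<le> \<Delta>"
    and cons: "norm (w - mean (\<lambda>j. F j (v j))) \<le> \<Delta>'"
  shows "norm (w - mean (\<lambda>j. F j (v i))) \<le> \<Delta>' + 2 * mean K * \<Delta>"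
proof -
  have "norm (mean (\<lambda>j. F j (v j)) - mean (\<lambda>j. F j (v i))) = norm (mean (\<lambda>j. F j (v j) - F j (v i)))"
    by (simp add: mean_diff)
  also have "\<dots> \<le> mean (\<lambda>j. norm (F j (v j) - F j (v i)))" by (rule norm_mean_le)
  also have "\<dots> \<le> mean (\<lambda>j. K j * (2 * \<Delta>))"
  proof (rule mean_mono)
    fix j
    have "norm (v j - v i) \<le> norm (v j - c) + norm (v i - c)"
      using norm_triangle_ineq4[of "v j - c" "v i - c"] by simp
    also have "\<dots> \<le> 2 * \<Delta>" using near[of j] near[of i] by simp
    finally have "norm (v j - v i) \<le> 2 * \<Delta>" .
    then show "norm (F j (v j) - F j (v i)) \<le> K j * (2 * \<Delta>)"
      using lip K by (meson mult_left_mono order_trans)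
  qed
  also have "\<dots> = 2 * mean K * \<Delta>" by (simp add: mean_mult_right)
  finally show ?thesis
    using cons norm_triangle_ineq[of "w - mean (\<lambda>j. F j (v j))" "mean (\<lambda>j. F j (v j)) - mean (\<lambda>j. F j (v i))"]
    by simp
qed

section \<open>Convergence of the method\<close>

theorem theorem2:
  fixes fi :: "'m::finite \<Rightarrow> real^'d \<Rightarrow> real"
    and f :: "real^'d \<Rightarrow> real"
    and grad :: "'m \<Rightarrow> real^'d \<Rightarrow> real^'d"
    and hess :: "'m \<Rightarrow> real^'d \<Rightarrow> real^'d^'d"
    and \<mu> L1 L2 :: "'m \<Rightarrow> real"
    and xstar :: "real^'d"
    and W :: "nat \<Rightarrow> real^'m^'m"
    and sx Tx sg Tg sH TH :: "nat \<Rightarrow> nat"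
    and x xhat ghat :: "nat \<Rightarrow> 'm \<Rightarrow> real^'d"
    and Hhat :: "nat \<Rightarrow> 'm \<Rightarrow> real^'d^'d"
    and \<epsilon> D \<gamma> \<alpha> L \<delta>1 \<delta>2 \<Delta>x \<Delta>g \<Delta>H bx bg bH :: real
    and N :: int
  assumes f_eq: "f = (\<lambda>z. mean (\<lambda>i. fi i z))"
    and \<mu>_pos: "\<And>i. \<mu> i > 0"
    and strong_convexity: "\<And>i. strongly_convex (\<mu> i) (fi i)"
    and gradients: "\<And>i z. GDERIV (fi i) z :> grad i z"
    and hessians: "\<And>i z. (grad i has_derivative (\<lambda>h. hess i z *v h)) (at z)"
    and gradient_Lipschitz: "\<And>i. (L1 i)-lipschitz_on UNIV (grad i)"
    and hessian_Lipschitz: "\<And>i y z. opnorm (hess i y - hess i z) \<le> L2 i * norm (y - z)"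
    and minimizer: "is_arg_min f (\<lambda>_. True) xstar"
    and mixing: "\<And>k. mixing_matrix (W k)"
    and \<epsilon>_pos: "\<epsilon> > 0"
    and D_eq: "D = (GREATEST r. \<exists>z. f z \<le> f (mean (x 0)) + \<epsilon> \<and> r = norm (z - xstar))"
    and \<gamma>_eq: "\<gamma> = 1 / D"
    and L_pos: "L > 0"
    and L_ge: "L \<ge> mean L2"
    and \<alpha>_eq: "\<alpha> = min (1 / 2) (sqrt (3 * mean \<mu> / (16 * (L + mean L2) * D)))"
    and N_eq: "N = \<lceil>1 / \<alpha> * ln (2 * (f (mean (x 0)) - f xstar) / \<epsilon>)\<rceil> - 1"
    and algorithm: "decentralized_cubic_newton W grad hess L \<gamma> (\<lambda>_. \<delta>1) (\<lambda>_. \<delta>2)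
          sx Tx sg Tg sH TH N x xhat ghat Hhat"
    and levels: "inexactness_levels grad hess N x xhat ghat Hhat (\<lambda>_. \<Delta>x) (\<lambda>_. \<Delta>g) (\<lambda>_. \<Delta>H)"
    and bx_eq: "bx = Min {\<alpha> * \<epsilon> / (24 * mean L1 * D),
          root 3 (\<alpha> * \<epsilon> / (4 * (L + mean L2))),
          2 * D * sqrt (\<alpha> * \<epsilon> * mean L1 /
            (3 * mean \<mu> * D\<^sup>2 * mean L1 + 4 * \<alpha> * \<epsilon> * (2 * mean L1 + D * mean L2))),
          mean \<mu> / (64 * (mean L1 / D + mean L2))}"
    and bg_eq: "bg = Min {\<alpha> * \<epsilon> / (12 * D), mean \<mu> * D / 32}"
    and bH_eq: "bH = mean \<mu> / 16"
    and \<Delta>x_le: "\<Delta>x \<le> bx"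
    and \<Delta>g_le: "\<Delta>g \<le> bg"
    and \<Delta>H_le: "\<Delta>H \<le> bH"
    and \<delta>_nonneg: "\<delta>1 \<ge> 0" "\<delta>2 \<ge> 0"
    and \<delta>1_ge: "\<delta>1 \<ge> \<Delta>g + 2 * mean L1 * \<Delta>x"
    and \<delta>2_ge: "\<delta>2 \<ge> \<Delta>H + 2 * mean L2 * \<Delta>x"
    and \<delta>1_le: "\<delta>1 \<le> bg + 2 * mean L1 * bx"
    and \<delta>2_le: "\<delta>2 \<le> bH + 2 * mean L2 * bx"
  shows "f (mean (x (nat (N + 1)))) - f xstar \<le> \<epsilon>"
proof -
  define G where "G z = mean (\<lambda>j. grad j z)" for z
  define H where "H z = mean (\<lambda>j. hess j z)" for z
  have grad_f: "GDERIV f z :> G z" for z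
    unfolding f_eq G_def by (rule GDERIV_mean[OF gradients])
  have hess_f: "(G has_derivative (\<lambda>h. H z *v h)) (at z)" for z
    unfolding G_def H_def mean_matrix_vector_mult by (rule has_derivative_mean[OF hessians])
  have grad_lip: "norm (grad j y - grad j z) \<le> L1 j * norm (y - z)" for j y z
    using lipschitz_onD[OF gradient_Lipschitz, of y z] by (simp add: dist_norm)
  have hess_lip: "norm (hess j y *v v - hess j z *v v) \<le> L2 j * norm v * norm (y - z)" for j y z v
  proof -
    have "norm ((hess j y - hess j z) *v v) \<le> opnorm (hess j y - hess j z) * norm v"
      by (rule norm_matrix_vector_le)
    also have "\<dots> \<le> L2 j * norm (y - z) * norm v"
      by (rule mult_right_mono[OF hessian_Lipschitz]) simp
    finally show ?thesis by (simp add: matrix_vector_mult_diff_rdistrib mult_ac)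
  qed
  have L1: "0 \<le> L1 j" for j
    using gradient_Lipschitz by (rule lipschitz_on_nonneg)
  \<comment> \<open>The Lipschitz bound forces the sign of its constant once two distinct points are inserted.\<close>
  have L2: "0 \<le> L2 j" for j
  proof -
    have "0 \<le> opnorm (hess j (vec 1) - hess j 0)" by (rule onorm_pos_le) simp
    also have "\<dots> \<le> L2 j * norm (vec 1 - 0 :: real^'d)" by (rule hessian_Lipschitz)
    finally have "0 \<le> L2 j * norm (vec 1 :: real^'d)" by simp
    moreover have "norm (vec 1 :: real^'d) > 0" by (simp add: vec_eq_iff)
    ultimately show ?thesis by (simp add: zero_le_mult_iff)
  qed
  have hess_f_lip: "norm ((H y - H z) *v v) \<le> mean L2 * norm (y - z) * norm v" for y z v
  proof -
    have "norm ((H y - H z) *v v) = norm (mean (\<lambda>j. hess j y *v v - hess j z *v v))"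
      by (simp add: H_def matrix_vector_mult_diff_rdistrib mean_matrix_vector_mult mean_diff)
    also have "\<dots> \<le> mean (\<lambda>j. norm (hess j y *v v - hess j z *v v))" by (rule norm_mean_le)
    also have "\<dots> \<le> mean (\<lambda>j. L2 j * norm v * norm (y - z))"
      by (rule mean_mono[OF hess_lip])
    finally show ?thesis by (simp add: mean_mult_right mult_ac)
  qed
  have \<mu>: "mean \<mu> > 0" by (rule mean_pos[OF \<mu>_pos])
  have K1: "mean L1 \<ge> 0" and K2: "mean L2 \<ge> 0" by (rule mean_nonneg; rule L1 L2)+
  have sc: "strongly_convex (mean \<mu>) f"
    unfolding f_eq by (rule strongly_convex_mean[OF strong_convexity])
  have conv: "convex_on UNIV f"
    using sc \<mu> by (intro strongly_convex_imp_convex_on) auto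
  have cont: "continuous_on UNIV f"
    using grad_f unfolding gderiv_def
    by (intro has_derivative_continuous_on) (auto intro: has_derivative_at_withinI)
  define e where "e k = f (mean (x k)) - f xstar" for k
  have e_nonneg: "0 \<le> e k" for k
    using minimizer by (simp add: e_def is_arg_min_linorder)
  have "f xstar < f (mean (x 0)) + \<epsilon>"
    using e_nonneg[of 0] \<epsilon>_pos by (simp add: e_def)
  note radius = sublevel_radius_attained[OF sc \<mu> cont minimizer this D_eq]
  have D: "D > 0" by (rule radius(2))
  have M: "L + mean L2 > 0" using L_pos K2 by simp
  let ?s = "3 * mean \<mu> / (16 * (L + mean L2) * D)"
  have s: "?s > 0" using \<mu> M D by simp
  have \<alpha>: "0 < \<alpha>" "\<alpha> \<le> 1 / 2" using s unfolding \<alpha>_eq by auto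
  have "\<alpha>\<^sup>2 \<le> (sqrt ?s)\<^sup>2" using \<alpha>(1) by (intro power_mono) (auto simp: \<alpha>_eq)
  also have "\<dots> = ?s" using s by simp
  finally have "\<alpha>\<^sup>2 * (16 * (L + mean L2) * D) \<le> 3 * mean \<mu>"
    using M D by (subst (asm) pos_le_divide_eq) auto
  then have \<alpha>_sq: "16 * (L + mean L2) * D * \<alpha>\<^sup>2 \<le> 3 * mean \<mu>"
    by (simp only: mult_ac)
  have bx: "bx \<le> \<alpha> * \<epsilon> / (24 * mean L1 * D)"
    "bx \<le> root 3 (\<alpha> * \<epsilon> / (4 * (L + mean L2)))"
    "bx \<le> 2 * D * sqrt (\<alpha> * \<epsilon> * mean L1 /
        (3 * mean \<mu> * D\<^sup>2 * mean L1 + 4 * \<alpha> * \<epsilon> * (2 * mean L1 + D * mean L2)))"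
    "bx \<le> mean \<mu> / (64 * (mean L1 / D + mean L2))"
    unfolding bx_eq by (rule Min_le; blast)+
  have bg: "bg \<le> \<alpha> * \<epsilon> / (12 * D)" "bg \<le> mean \<mu> * D / 32"
    unfolding bg_eq by (rule Min_le; blast)+
  have contraction: "e (Suc k) \<le> (1 - \<alpha>) * e k + \<alpha> * \<epsilon> / 2"
    if k: "int k \<le> N" and ek: "e k \<le> e 0 + \<epsilon>" for k
  proof -
    have near: "norm (xhat k i - mean (x k)) \<le> \<Delta>x" for i
      using levels k by (simp add: inexactness_levels_def)
    have g: "norm (ghat k i - mean (\<lambda>j. grad j (xhat k j))) \<le> \<Delta>g" for i
      using levels k by (simp add: inexactness_levels_def)
    have B: "opnorm (Hhat k i - mean (\<lambda>j. hess j (xhat k j))) \<le> \<Delta>H" for i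
      using levels k by (simp add: inexactness_levels_def)
    have step: "is_arg_min (cubic_model L \<gamma> \<delta>1 \<delta>2 (ghat k i) (Hhat k i) (xhat k i))
        (\<lambda>_. True) (x (Suc k) i)" for i
      using algorithm k unfolding decentralized_cubic_newton_def by blast
    \<comment> \<open>The levels bound something only at an iteration that is made, so nonnegativity is available
      only inside the step.\<close>
    have \<Delta>x: "0 \<le> \<Delta>x" using near norm_ge_zero order_trans by blast
    have g': "norm (ghat k i - G (xhat k i)) \<le> \<delta>1" for i
      using inexact_mean_le[of grad L1 "xhat k", OF grad_lip L1 near g] \<delta>1_ge
      unfolding G_def by (rule order_trans)
    \<comment> \<open>The error level is in the operator norm, so matrices are compared by their action on a
      fixed vector.\<close>
    have B': "norm ((Hhat k i - H (xhat k i)) *v v) \<le> \<delta>2 * norm v" for i v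
    proof -
      have "norm (Hhat k i *v v - mean (\<lambda>j. hess j (xhat k j) *v v)) \<le> \<Delta>H * norm v"
        using norm_matrix_vector_le[of "Hhat k i - mean (\<lambda>j. hess j (xhat k j))" v]
          mult_right_mono[OF B[of i] norm_ge_zero[of v]]
        by (simp add: matrix_vector_mult_diff_rdistrib mean_matrix_vector_mult)
      then have "norm (Hhat k i *v v - mean (\<lambda>j. hess j (xhat k i) *v v))
          \<le> \<Delta>H * norm v + 2 * mean (\<lambda>j. L2 j * norm v) * \<Delta>x"
        by (intro inexact_mean_le[where F = "\<lambda>j y. hess j y *v v" and c = "mean (x k)"] hess_lip near) (simp add: L2)
      also have "\<dots> = (\<Delta>H + 2 * mean L2 * \<Delta>x) * norm v"
        by (simp add: mean_mult_right algebra_simps)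
      also have "\<dots> \<le> \<delta>2 * norm v" using \<delta>2_ge by (rule mult_right_mono) simp
      finally show ?thesis
        by (simp add: H_def matrix_vector_mult_diff_rdistrib mean_matrix_vector_mult)
    qed
    have \<gamma>: "\<gamma> > 0" using D by (simp add: \<gamma>_eq)
    note budget = inexactness_budget[OF \<alpha>(1) \<epsilon>_pos D \<mu> M K1 K2 bx(1) order_trans[OF \<Delta>x_le bx(2)]
        order_trans[OF \<Delta>x_le bx(3)] bx(4) bg \<Delta>x \<delta>1_le \<delta>2_le[unfolded bH_eq]]
    have \<gamma>\<delta>: "\<gamma> * \<delta>1 = \<delta>1 / D" "\<delta>1 / \<gamma> = \<delta>1 * D" by (simp_all add: \<gamma>_eq)
    have R: "norm (mean (x k) - xstar) \<le> D"
      using ek by (intro radius(1)) (simp add: e_def)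
    have node: "f (x (Suc k) i) - f xstar \<le> (1 - \<alpha>) * e k + \<alpha> * \<epsilon> / 2" for i
    proof -
      have "f (x (Suc k) i) \<le> f y + \<delta>1 * D + (\<delta>1 / D + \<delta>2) * (norm (y - xhat k i))\<^sup>2
          + (L + mean L2) / 6 * norm (y - xhat k i) ^ 3" for y
        using cubic_step_le[OF grad_f hess_f hess_f_lip g' B' \<gamma> L_ge step] unfolding \<gamma>\<delta> .
      then have "f (x (Suc k) i) - f xstar \<le> (1 - \<alpha>) * (f (mean (x k)) - f xstar)
          + (\<delta>1 * D + 2 * (\<delta>1 / D + \<delta>2) * \<Delta>x\<^sup>2 + 2 / 3 * (L + mean L2) * \<Delta>x ^ 3)"
        by (rule cubic_step_contraction[OF sc order_less_imp_le[OF \<mu>]])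
           (use D \<delta>_nonneg M near R \<alpha> \<alpha>_sq budget(1) in auto)
      with budget(2) show ?thesis unfolding e_def by linarith
    qed
    have "e (Suc k) \<le> mean (\<lambda>i. f (x (Suc k) i)) - f xstar"
      unfolding e_def using convex_on_mean_le[OF conv, of "x (Suc k)"] by simp
    also have "\<dots> = mean (\<lambda>i. f (x (Suc k) i) - f xstar)" by (simp add: mean_diff)
    also have "\<dots> \<le> mean (\<lambda>i::'m. (1 - \<alpha>) * e k + \<alpha> * \<epsilon> / 2)" by (rule mean_mono[OF node])
    finally show ?thesis by simp
  qed
  let ?n = "nat (N + 1)"
  have "e ?n \<le> (1 - \<alpha>) ^ ?n * e 0 + \<epsilon> / 2"
  proof (rule perturbed_contraction_iterate[where e = e and n = ?n])
    show "e (Suc k) \<le> (1 - \<alpha>) * e k + \<alpha> * \<epsilon> / 2" if "k < ?n" "e k \<le> e 0 + \<epsilon>" for k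
      using that by (intro contraction) auto
  qed (use \<alpha> \<epsilon>_pos e_nonneg in auto)
  moreover have "(1 - \<alpha>) ^ ?n * e 0 \<le> \<epsilon> / 2"
    using \<alpha> \<epsilon>_pos e_nonneg by (intro contraction_iteration_count) (auto simp: N_eq e_def)
  ultimately show ?thesis unfolding e_def by linarith
qed

end
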